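(* Let $(A_b,A_w)$ be a pairwise comparison system on the Saaty scale with $n$ criteria and having $a_{bw}$ as the best-to-worst comparison value, let $\epsilon^*$ be the corresponding optimal objective value of the linear best-worst problem (P) stated in the context, and let $D_1,D_2,\epsilon_i,\epsilon_{i,j},\eta$ be as defined in the context. Then the following statements hold. 1. For $n\geq 3$, if $\eta=\epsilon_{i_0}$ for some $i_0\in D_1$, then $\epsilon^*\leq\frac{a_{bw}-1}{3(n-1+a_{bw})}$. Furthermore, $(A_b',A_w')$ defined by $$a_{1n}'=a_{bw},\quad a_{12}'=a_{2n}'=1,\quad a_{1i}'=a_{bw},\ a_{in}'=1\ \text{ for } i\in\{3,4,\ldots,n-1\}$$ is a PCS with $n$ criteria with $c_1$ as the best and $c_n$ as the worst criterion, having $a_{bw}$ as the best-to-worst comparison value, for which the optimal objective value is $\epsilon^*=\frac{a_{bw}-1}{3(n-1+a_{bw})}$. 2. For $n\geq 3$, if $\eta=\epsilon_{j_0}$ for some $j_0\in D_2$, then $\epsilon^*\leq\frac{a_{bw}(a_{bw}-1)}{2a_{bw}^2+(3n-4)a_{bw}+2}$. Furthermore, $(A_b',A_w')$ defined by $$a_{1n}'=a_{bw},\quad a_{12}'=a_{2n}'=a_{bw},\quad a_{1i}'=a_{bw},\ a_{in}'=1\ \text{ for } i\in\{3,4,\ldots,n-1\}$$ is a PCS with $n$ criteria with $c_1$ as the best and $c_n$ as the worst criterion, having $a_{bw}$ as the best-to-worst comparison value, for which the optimal objective value is $\epsilon^*=\frac{a_{bw}(a_{bw}-1)}{2a_{bw}^2+(3n-4)a_{bw}+2}$.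 3. For $n\geq 4$, if $\eta=\epsilon_{i_0,j_0}$ for some $i_0\in D_1$ and $j_0\in D_2$, then $$\epsilon^*\leq\frac{a_{bw}^2-1}{3a_{bw}^2+6a_{bw}+7+(n-4)\min\{a_{bw}^2+a_{bw}+2,\ 1+3a_{bw}\}}.$$ Furthermore, $(A_b',A_w')$ defined by $$a_{1n}'=a_{bw},\quad a_{12}'=a_{2n}'=1,\quad a_{13}'=a_{3n}'=a_{bw},\quad a_{1i}'=a_{bw},\ a_{in}'=1\ \text{ for } i\in\{4,\ldots,n-1\}$$ is a PCS with $n$ criteria with $c_1$ as the best and $c_n$ as the worst criterion, having $a_{bw}$ as the best-to-worst comparison value, for which the optimal objective value is $\epsilon^*=\frac{a_{bw}^2-1}{3a_{bw}^2+6a_{bw}+7+(n-4)\min\{a_{bw}^2+a_{bw}+2,\ 1+3a_{bw}\}}$.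
   Context: Let $C=\{1,2,\ldots,n\}$ with $n\geq 3$ index the decision criteria $c_1,\ldots,c_n$, let $b,w\in C$ with $b\neq w$ be the (indices of the) best and worst criteria, and let $D=C\setminus\{b,w\}$. A pairwise comparison system (PCS) is a pair $(A_b,A_w)$ with $A_b=(a_{b1},\ldots,a_{bn})$ and $A_w=(a_{1w},\ldots,a_{nw})^T$, where $a_{bb}=a_{ww}=1$ and the entry $a_{bw}$ is common to both vectors. A PCS is on the Saaty scale if all its entries lie in $\{1,2,\ldots,9\}$; moreover, the best-to-worst value is the largest: $a_{bi}\leq a_{bw}$ and $a_{iw}\leq a_{bw}$ for all $i\in D$. Define $$D_1=\{i\in D: a_{bi}a_{iw}<a_{bw}\},\quad D_2=\{i\in D: a_{bi}a_{iw}>a_{bw}\},$$ $$\epsilon_i=\frac{|a_{bi}a_{iw}-a_{bw}|}{a_{bi}+2},\quad \epsilon_{i,j}=\frac{|a_{bi}a_{iw}-a_{bj}a_{jw}|}{a_{bi}+a_{bj}+2}\quad (i,j\in D),$$ $$\eta=\max\{\epsilon_i,\epsilon_{j,k}: i\in D,\ j\in D_1,\ k\in D_2\}.$$ Problem (P), the linear best-worst problem associated with a PCS: minimize $\epsilon$ subject to $|w_b-a_{bi}w_i|\leq\epsilon$, $|w_i-a_{iw}w_w|\leq\epsilon$ for all $i\in D$, $|w_b-a_{bw}w_w|\leq\epsilon$, $w_1+\cdots+w_n=1$ and $w_j\geq 0$ for all $j\in C$. *)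

theory Defs
  imports "HOL-Analysis.Analysis"
begin

text \<open>
  Criteria are the indices \<open>1, \<dots>, n\<close>. The comparison vectors are functions
  \<open>Ab i\<close> (best criterion \<open>b\<close> compared to \<open>i\<close>) and \<open>Aw i\<close> (criterion \<open>i\<close> compared to the worst
  criterion \<open>w\<close>), of which only the values on \<open>{1..n}\<close> matter. The best-to-worst
  value \<open>a\<^sub>b\<^sub>w\<close> is \<open>Ab w\<close>, which coincides with \<open>Aw b\<close>.
\<close>

definition criteria :: "nat \<Rightarrow> nat set" where
  "criteria n = {1..n}"

definition mid_criteria :: "nat \<Rightarrow> nat \<Rightarrow> nat \<Rightarrow> nat set" where
  "mid_criteria n b w = criteria n - {b, w}"

definition is_pcs :: "nat \<Rightarrow> nat \<Rightarrow> nat \<Rightarrow> (nat \<Rightarrow> real) \<Rightarrow> (nat \<Rightarrow> real) \<Rightarrow> bool" where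
  "is_pcs n b w Ab Aw \<longleftrightarrow>
     b \<in> criteria n \<and> w \<in> criteria n \<and> b \<noteq> w \<and>
     Ab b = 1 \<and> Aw w = 1 \<and> Ab w = Aw b"

definition saaty_scale :: "real set" where
  "saaty_scale = {1, 2, 3, 4, 5, 6, 7, 8, 9}"

definition is_saaty_pcs :: "nat \<Rightarrow> nat \<Rightarrow> nat \<Rightarrow> (nat \<Rightarrow> real) \<Rightarrow> (nat \<Rightarrow> real) \<Rightarrow> bool" where
  "is_saaty_pcs n b w Ab Aw \<longleftrightarrow>
     is_pcs n b w Ab Aw \<and>
     (\<forall>i\<in>criteria n. Ab i \<in> saaty_scale \<and> Aw i \<in> saaty_scale) \<and>
     (\<forall>i\<in>mid_criteria n b w. Ab i \<le> Ab w \<and> Aw i \<le> Ab w)"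

definition D1 :: "nat \<Rightarrow> nat \<Rightarrow> nat \<Rightarrow> (nat \<Rightarrow> real) \<Rightarrow> (nat \<Rightarrow> real) \<Rightarrow> nat set" where
  "D1 n b w Ab Aw = {i \<in> mid_criteria n b w. Ab i * Aw i < Ab w}"

definition D2 :: "nat \<Rightarrow> nat \<Rightarrow> nat \<Rightarrow> (nat \<Rightarrow> real) \<Rightarrow> (nat \<Rightarrow> real) \<Rightarrow> nat set" where
  "D2 n b w Ab Aw = {i \<in> mid_criteria n b w. Ab i * Aw i > Ab w}"

definition eps1 :: "nat \<Rightarrow> (nat \<Rightarrow> real) \<Rightarrow> (nat \<Rightarrow> real) \<Rightarrow> nat \<Rightarrow> real" where
  "eps1 w Ab Aw i = \<bar>Ab i * Aw i - Ab w\<bar> / (Ab i + 2)"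

definition eps2 :: "(nat \<Rightarrow> real) \<Rightarrow> (nat \<Rightarrow> real) \<Rightarrow> nat \<Rightarrow> nat \<Rightarrow> real" where
  "eps2 Ab Aw i j = \<bar>Ab i * Aw i - Ab j * Aw j\<bar> / (Ab i + Ab j + 2)"

definition eta :: "nat \<Rightarrow> nat \<Rightarrow> nat \<Rightarrow> (nat \<Rightarrow> real) \<Rightarrow> (nat \<Rightarrow> real) \<Rightarrow> real" where
  "eta n b w Ab Aw =
     Max ({eps1 w Ab Aw i | i. i \<in> mid_criteria n b w} \<union>
          {eps2 Ab Aw j k | j k. j \<in> D1 n b w Ab Aw \<and> k \<in> D2 n b w Ab Aw})"

definition feasible ::
  "nat \<Rightarrow> nat \<Rightarrow> nat \<Rightarrow> (nat \<Rightarrow> real) \<Rightarrow> (nat \<Rightarrow> real) \<Rightarrow> (nat \<Rightarrow> real) \<Rightarrow> real \<Rightarrow> bool" where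
  "feasible n b w Ab Aw W \<epsilon> \<longleftrightarrow>
     (\<forall>i\<in>mid_criteria n b w. \<bar>W b - Ab i * W i\<bar> \<le> \<epsilon> \<and> \<bar>W i - Aw i * W w\<bar> \<le> \<epsilon>) \<and>
     \<bar>W b - Ab w * W w\<bar> \<le> \<epsilon> \<and>
     (\<Sum>j\<in>criteria n. W j) = 1 \<and>
     (\<forall>j\<in>criteria n. 0 \<le> W j)"

definition optimal_value ::
  "nat \<Rightarrow> nat \<Rightarrow> nat \<Rightarrow> (nat \<Rightarrow> real) \<Rightarrow> (nat \<Rightarrow> real) \<Rightarrow> real \<Rightarrow> bool" where
  "optimal_value n b w Ab Aw \<epsilon> \<longleftrightarrow>
     (\<exists>W. feasible n b w Ab Aw W \<epsilon>) \<and>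
     (\<forall>W \<epsilon>'. feasible n b w Ab Aw W \<epsilon>' \<longrightarrow> \<epsilon> \<le> \<epsilon>')"

text \<open>
  The minimum always exists and is unique, so \<^const>\<open>optimal_value\<close> determines a
  well-defined number for every pairwise comparison system.
\<close>

lemma optimal_value_ex1:
  assumes "is_pcs n b w Ab Aw"
  shows "\<exists>!\<epsilon>. optimal_value n b w Ab Aw \<epsilon>"
proof -
  have bC: "b \<in> criteria n" using assms by (simp add: is_pcs_def)
  have finC: "finite (criteria n)" by (simp add: criteria_def)
  have finD: "finite (mid_criteria n b w)" by (simp add: mid_criteria_def finC)
  define W0 :: "nat \<Rightarrow> real" where "W0 = (\<lambda>i. if i = b then 1 else 0)"
  define f where "f = (\<lambda>i. \<bar>W0 b - Ab i * W0 i\<bar> + \<bar>W0 i - Aw i * W0 w\<bar>)"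
  define e0 where "e0 = (\<Sum>i\<in>mid_criteria n b w. f i) + \<bar>W0 b - Ab w * W0 w\<bar>"
  have fpos: "f i \<ge> 0" for i by (simp add: f_def)
  have fle: "f i \<le> e0" if "i \<in> mid_criteria n b w" for i
    using member_le_sum[of i "mid_criteria n b w" f] that fpos finD by (simp add: e0_def)
  have F0: "feasible n b w Ab Aw W0 e0"
    unfolding feasible_def
  proof (intro conjI ballI)
    fix i assume i: "i \<in> mid_criteria n b w"
    show "\<bar>W0 b - Ab i * W0 i\<bar> \<le> e0" "\<bar>W0 i - Aw i * W0 w\<bar> \<le> e0"
      using fle[OF i] by (auto simp: f_def)
  next
    show "\<bar>W0 b - Ab w * W0 w\<bar> \<le> e0"
      using sum_nonneg[of "mid_criteria n b w" f] fpos by (simp add: e0_def)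
    show "(\<Sum>j\<in>criteria n. W0 j) = 1" using bC finC by (simp add: W0_def)
  qed (simp add: W0_def)
  have e0pos: "e0 \<ge> 0" using F0 by (auto simp: feasible_def)
  define S where "S = (Pi\<^sub>E UNIV (\<lambda>_. {0..1::real}) \<times> {0..e0}) \<inter>
     {p. feasible n b w Ab Aw (fst p) (snd p)}"
  have "compactin (product_topology (\<lambda>_. euclidean) UNIV) (Pi\<^sub>E UNIV (\<lambda>_::nat. {0..1::real}))"
    unfolding compactin_PiE by auto
  then have "compact (Pi\<^sub>E UNIV (\<lambda>_::nat. {0..1::real}))"
    by (simp add: euclidean_product_topology)
  then have cmp: "compact (Pi\<^sub>E UNIV (\<lambda>_::nat. {0..1::real}) \<times> {0..e0})"
    by (intro compact_Times) auto
  have coord: "continuous_on UNIV (\<lambda>p::(nat \<Rightarrow> real) \<times> real. fst p i)" for i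
    by (rule continuous_on_product_then_coordinatewise) (intro continuous_intros)
  have "closed {p. feasible n b w Ab Aw (fst p) (snd p)}"
    unfolding feasible_def Ball_def
    by (intro closed_Collect_conj closed_Collect_all closed_Collect_imp closed_Collect_le
          closed_Collect_eq continuous_intros coord) auto
  with cmp have "compact S" unfolding S_def by (rule compact_Int_closed)
  moreover have "(W0, e0) \<in> S" using F0 e0pos by (auto simp: S_def W0_def)
  moreover have "continuous_on S snd" by (intro continuous_intros)
  ultimately obtain p where p: "p \<in> S" and pmin: "\<And>q. q \<in> S \<Longrightarrow> snd p \<le> snd q"
    using continuous_attains_inf[of S snd] by blast
  have "snd p \<le> e" if F: "feasible n b w Ab Aw W e" for W e
  proof (cases "e \<le> e0")
    case False
    then show ?thesis using p by (auto simp: S_def)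
  next
    case True
    define V where "V = (\<lambda>i. if i \<in> criteria n then W i else 0)"
    have "V b = W b" "V w = W w" "\<And>i. i \<in> mid_criteria n b w \<Longrightarrow> V i = W i"
      "\<And>i. i \<in> criteria n \<Longrightarrow> V i = W i" "(\<Sum>j\<in>criteria n. V j) = (\<Sum>j\<in>criteria n. W j)"
      using assms by (auto simp: V_def is_pcs_def mid_criteria_def)
    then have FV: "feasible n b w Ab Aw V e" using F by (simp add: feasible_def)
    have nn: "\<forall>j\<in>criteria n. 0 \<le> W j" and s1: "(\<Sum>j\<in>criteria n. W j) = 1"
      using F by (auto simp: feasible_def)
    have "W i \<le> 1" if "i \<in> criteria n" for i
      using member_le_sum[of i "criteria n" W] that nn finC s1 by auto
    then have "V i \<in> {0..1}" for i using nn by (auto simp: V_def)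
    moreover have "0 \<le> e" using F by (auto simp: feasible_def)
    ultimately have "(V, e) \<in> S" using FV True by (auto simp: S_def)
    then show ?thesis using pmin[of "(V, e)"] by simp
  qed
  moreover have "feasible n b w Ab Aw (fst p) (snd p)" using p by (simp add: S_def)
  ultimately have "optimal_value n b w Ab Aw (snd p)" by (auto simp: optimal_value_def)
  then show ?thesis by (auto simp: optimal_value_def intro!: antisym)
qed

text \<open>
  Comparison systems attaining the bounds, with best criterion \<open>1\<close>, worst criterion \<open>n\<close> and
  best-to-worst value \<open>a\<close>. The final branch covers the remaining middle criteria
  and also index \<open>n\<close>, where the comparison to the best is \<open>a\<close> and the comparison
  to the worst is \<open>1\<close>.
\<close>

definition Ab_ex1 :: "real \<Rightarrow> nat \<Rightarrow> real" where
  "Ab_ex1 a i = (if i = 1 then 1 else if i = 2 then 1 else a)"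

definition Aw_ex1 :: "real \<Rightarrow> nat \<Rightarrow> real" where
  "Aw_ex1 a i = (if i = 1 then a else if i = 2 then 1 else 1)"

definition Ab_ex2 :: "real \<Rightarrow> nat \<Rightarrow> real" where
  "Ab_ex2 a i = (if i = 1 then 1 else if i = 2 then a else a)"

definition Aw_ex2 :: "real \<Rightarrow> nat \<Rightarrow> real" where
  "Aw_ex2 a i = (if i = 1 then a else if i = 2 then a else 1)"

definition Ab_ex3 :: "real \<Rightarrow> nat \<Rightarrow> real" where
  "Ab_ex3 a i = (if i = 1 then 1 else if i = 2 then 1 else if i = 3 then a else a)"

definition Aw_ex3 :: "real \<Rightarrow> nat \<Rightarrow> real" where
  "Aw_ex3 a i = (if i = 1 then a else if i = 2 then 1 else if i = 3 then a else 1)"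

end

theory Submission
  imports Defs
begin

text \<open>
  Problem (P) is homogeneous in \<open>(W, \<epsilon>)\<close> apart from the normalisation of the total weight, so
  \<open>1 / \<epsilon>\<^sup>*\<close> is the largest total weight reachable when all deviations are at most \<open>1\<close>.
  In that scaling write \<open>x\<close> and \<open>y\<close> for the weights of the worst and of the best criterion, and
  \<open>p, q\<close> for the two comparison values of a middle criterion. Its weight can be chosen exactly when
  \<open>\<bar>y - p q x\<bar> \<le> p + 1\<close>, and the largest choice is \<open>min ((y + 1) / p) (q x + 1)\<close>
  (lemma \<open>optimal_times_total_weight_le_1\<close>). Together with \<open>\<bar>y - a x\<bar> \<le> 1\<close> these conditions confine
  \<open>y\<close> between lower bounds (from \<open>a\<close> and from \<open>D\<^sub>2\<close>) and upper bounds (from \<open>a\<close> and from \<open>D\<^sub>1\<close>), and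
  the quantities \<open>\<epsilon>\<^sub>i\<close>, \<open>\<epsilon>\<^sub>i\<^sub>,\<^sub>j\<close> are the reciprocals of the values of \<open>x\<close> at which a lower bound meets an
  upper one. Hence \<open>x\<close> can be as large as \<open>1 / \<eta>\<close> (lemma \<open>bounds_compatible\<close>), and there \<open>y\<close> is the
  common value of the two bounds that meet.

  The criteria attaining \<open>\<eta>\<close> thus determine \<open>x\<close> and \<open>y\<close>, and every weight at this point increases with
  \<open>x\<close> and \<open>y\<close>. All comparison values lie between \<open>1\<close> and \<open>a\<close>. The smallest possible total weight is
  obtained by pushing the comparison values of the critical criteria to the extremes:
  \<open>p = q = 1\<close> for a criterion in \<open>D\<^sub>1\<close>, \<open>p = q = a\<close> for one in \<open>D\<^sub>2\<close>, and
  \<open>p = a\<close>, \<open>q = 1\<close> for all others. This yields the three upper bounds on \<open>\<epsilon>\<^sup>*\<close>, and these extremal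
  choices are precisely the systems in the statement. Those systems satisfy the hypotheses of the
  corresponding bounds, so only the reverse inequality is left for them. It comes from chaining the
  constraints of (P), which bounds each weight, and thereby the total weight \<open>1\<close>, by a multiple of \<open>\<epsilon>\<close>.
\<close>

section \<open>Index sets and the critical value\<close>

lemma finite_mid_criteria [simp]: "finite (mid_criteria n b w)"
  by (simp add: mid_criteria_def criteria_def)

lemma card_mid_criteria:
  assumes "is_pcs n b w Ab Aw"
  shows "card (mid_criteria n b w) = n - 2"
  using assms by (auto simp: mid_criteria_def is_pcs_def criteria_def card_Diff_subset)

lemma sum_criteria:
  assumes "is_pcs n b w Ab Aw"
  shows "(\<Sum>j\<in>criteria n. W j) = W b + W w + (\<Sum>j\<in>mid_criteria n b w. (W j :: real))"
proof -
  have "criteria n = insert b (insert w (mid_criteria n b w))"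
    using assms by (auto simp: mid_criteria_def is_pcs_def)
  moreover have "b \<notin> insert w (mid_criteria n b w)" "w \<notin> mid_criteria n b w"
    using assms by (auto simp: mid_criteria_def is_pcs_def)
  ultimately show ?thesis by simp
qed

lemma sum_ge_special_plus_const:
  fixes f :: "'a \<Rightarrow> real"
  assumes "finite A" "B \<subseteq> A" "\<And>k. k \<in> A - B \<Longrightarrow> c \<le> f k"
  shows "sum f B + real (card A - card B) * c \<le> sum f A"
proof -
  have "real (card (A - B)) * c \<le> sum f (A - B)"
    using assms(3) by (intro sum_bounded_below) auto
  moreover have "card (A - B) = card A - card B"
    using assms by (meson card_Diff_subset finite_subset)
  ultimately show ?thesis
    using sum.subset_diff[OF assms(2,1), of f] by simp
qed

lemma sum_le_special_plus_const:
  fixes f :: "'a \<Rightarrow> real"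
  assumes "finite A" "B \<subseteq> A" "\<And>k. k \<in> A - B \<Longrightarrow> f k \<le> c"
  shows "sum f A \<le> sum f B + real (card A - card B) * c"
  using sum_ge_special_plus_const[of A B "- c" "\<lambda>k. - f k"] assms
  by (simp add: sum_negf)

lemma saaty_bounds:
  assumes "is_saaty_pcs n b w Ab Aw"
  shows "1 \<le> Ab w" "\<And>i. i \<in> mid_criteria n b w \<Longrightarrow> 1 \<le> Ab i \<and> Ab i \<le> Ab w \<and> 1 \<le> Aw i \<and> Aw i \<le> Ab w"
proof -
  have "1 \<le> v" if "v \<in> saaty_scale" for v
    using that by (auto simp: saaty_scale_def)
  then show "1 \<le> Ab w" "\<And>i. i \<in> mid_criteria n b w \<Longrightarrow> 1 \<le> Ab i \<and> Ab i \<le> Ab w \<and> 1 \<le> Aw i \<and> Aw i \<le> Ab w"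
    using assms by (auto simp: is_saaty_pcs_def is_pcs_def mid_criteria_def)
qed

lemma finite_eta_set:
  "finite ({eps1 w Ab Aw i | i. i \<in> mid_criteria n b w} \<union>
           {eps2 Ab Aw j k | j k. j \<in> D1 n b w Ab Aw \<and> k \<in> D2 n b w Ab Aw})"
proof -
  have "finite (D1 n b w Ab Aw)" "finite (D2 n b w Ab Aw)"
    by (simp_all add: D1_def D2_def)
  then show ?thesis by (auto intro: finite_image_set2)
qed

lemma eps1_le_eta: "i \<in> mid_criteria n b w \<Longrightarrow> eps1 w Ab Aw i \<le> eta n b w Ab Aw"
  unfolding eta_def by (rule Max_ge[OF finite_eta_set]) blast

lemma eps2_le_eta:
  "j \<in> D1 n b w Ab Aw \<Longrightarrow> k \<in> D2 n b w Ab Aw \<Longrightarrow> eps2 Ab Aw j k \<le> eta n b w Ab Aw"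
  unfolding eta_def by (rule Max_ge[OF finite_eta_set]) blast

section \<open>The scaled problem\<close>

text \<open>
  With all deviations at most \<open>1\<close>, the conditions \<open>\<bar>y - p v\<bar> \<le> 1\<close> and \<open>\<bar>v - q x\<bar> \<le> 1\<close> confine the weight \<open>v\<close> of a
  middle criterion to the intersection of two intervals. This is the right end of that intersection.
\<close>

definition max_mid_weight :: "(nat \<Rightarrow> real) \<Rightarrow> (nat \<Rightarrow> real) \<Rightarrow> real \<Rightarrow> real \<Rightarrow> nat \<Rightarrow> real" where
  "max_mid_weight Ab Aw x y k = min ((y + 1) / Ab k) (Aw k * x + 1)"

text \<open>
  The two intervals for the weight of criterion \<open>k\<close> intersect iff \<open>\<bar>y - p q x\<bar> \<le> p + 1\<close>. One of these two
  inequalities already follows from \<open>\<bar>y - a x\<bar> \<le> 1\<close>, so that the criteria in \<open>D\<^sub>1\<close> only bound \<open>y\<close> from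
  above and those in \<open>D\<^sub>2\<close> only from below. Dividing by the total weight gives a feasible point of (P).
\<close>

lemma optimal_times_total_weight_le_1:
  assumes pcs: "is_saaty_pcs n b w Ab Aw"
    and opt: "optimal_value n b w Ab Aw \<epsilon>"
    and x: "0 \<le> x" and y: "0 < y"
    and bw: "\<bar>y - Ab w * x\<bar> \<le> 1"
    and up: "\<And>k. k \<in> D1 n b w Ab Aw \<Longrightarrow> y \<le> Ab k * Aw k * x + Ab k + 1"
    and low: "\<And>k. k \<in> D2 n b w Ab Aw \<Longrightarrow> Ab k * Aw k * x - Ab k - 1 \<le> y"
  shows "\<epsilon> * (x + y + (\<Sum>k\<in>mid_criteria n b w. max_mid_weight Ab Aw x y k)) \<le> 1"
proof -
  let ?M = "max_mid_weight Ab Aw x y"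
  define S where "S = x + y + (\<Sum>k\<in>mid_criteria n b w. ?M k)"
  define V where "V = (\<lambda>i. if i = b then y else if i = w then x else ?M i)"
  have pcs': "is_pcs n b w Ab Aw" using pcs by (simp add: is_saaty_pcs_def)
  then have bw_ne: "b \<noteq> w" by (simp add: is_pcs_def)
  note sb = saaty_bounds[OF pcs]
  have Vb: "V b = y" and Vw: "V w = x" using bw_ne by (auto simp: V_def)
  have Vk: "V k = ?M k" if "k \<in> mid_criteria n b w" for k
    using that by (auto simp: V_def mid_criteria_def)
  have Mnn: "0 \<le> ?M k" if "k \<in> mid_criteria n b w" for k
    using sb(2)[OF that] x y by (simp add: max_mid_weight_def)
  have S: "0 < S"
    unfolding S_def using x y sum_nonneg[of "mid_criteria n b w" ?M] Mnn by fastforce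
  have fit: "\<bar>y - Ab k * ?M k\<bar> \<le> 1 \<and> \<bar>?M k - Aw k * x\<bar> \<le> 1"
    if k: "k \<in> mid_criteria n b w" for k
  proof -
    define p q where "p = Ab k" and "q = Aw k"
    have p: "1 \<le> p" using sb(2)[OF k] by (simp add: p_def)
    have "\<bar>y - p * q * x\<bar> \<le> p + 1"
    proof (cases "p * q" "Ab w" rule: linorder_cases)
      case less
      then have "p * q * x \<le> Ab w * x" using x by (intro mult_right_mono) auto
      then show ?thesis using bw p up[of k] k less by (auto simp: D1_def p_def q_def)
    next
      case equal
      then show ?thesis using bw p by simp
    next
      case greater
      then have "Ab w * x \<le> p * q * x" using x by (intro mult_right_mono) auto
      then show ?thesis using bw p low[of k] k greater by (auto simp: D2_def p_def q_def)
    qed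
    then have "y \<le> p * (q * x + 1) + 1" "q * x - 1 \<le> (y + 1) / p"
      using p by (auto simp: field_simps)
    moreover have "p * ((y + 1) / p) = y + 1" using p by simp
    moreover have "p * ?M k = min (p * ((y + 1) / p)) (p * (q * x + 1))"
      using p by (simp add: max_mid_weight_def p_def q_def min_mult_distrib_left)
    ultimately show ?thesis
      unfolding p_def[symmetric] q_def[symmetric]
      using p by (auto simp: max_mid_weight_def p_def[symmetric] q_def[symmetric] min_def split: if_splits)
  qed
  have "feasible n b w Ab Aw (\<lambda>i. V i / S) (1 / S)"
    unfolding feasible_def
  proof (intro conjI ballI)
    have scale: "\<bar>u / S - c * (v / S)\<bar> \<le> 1 / S" if "\<bar>u - c * v\<bar> \<le> 1" for u v c :: real
    proof -
      have "u / S - c * (v / S) = (u - c * v) / S" by (simp add: diff_divide_distrib)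
      then show ?thesis using that S by (simp add: abs_divide divide_right_mono)
    qed
    show "\<bar>V b / S - Ab w * (V w / S)\<bar> \<le> 1 / S"
      using bw by (intro scale) (simp add: Vb Vw)
    fix i assume i: "i \<in> mid_criteria n b w"
    show "\<bar>V b / S - Ab i * (V i / S)\<bar> \<le> 1 / S" "\<bar>V i / S - Aw i * (V w / S)\<bar> \<le> 1 / S"
      using fit[OF i] by (intro scale; simp add: Vb Vw Vk[OF i])+
  next
    have "(\<Sum>j\<in>criteria n. V j) = S"
      by (simp add: sum_criteria[OF pcs'] Vb Vw Vk S_def)
    then show "(\<Sum>j\<in>criteria n. V j / S) = 1"
      using S by (simp flip: sum_divide_distrib)
    fix j assume "j \<in> criteria n"
    then have "0 \<le> V j"
      using x y Mnn by (auto simp: V_def mid_criteria_def)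
    then show "0 \<le> V j / S" using S by simp
  qed
  then have "\<epsilon> \<le> 1 / S" using opt by (auto simp: optimal_value_def)
  then show ?thesis using S unfolding S_def[symmetric] by (simp add: field_simps)
qed

text \<open>
  Up to \<open>x = 1 / \<eta>\<close> no lower bound on \<open>y\<close> exceeds an upper one: each difference is linear in \<open>x\<close> and
  vanishes at the reciprocal of one of the quantities whose maximum is \<open>\<eta>\<close>.
\<close>

lemma bounds_compatible:
  assumes pcs: "is_saaty_pcs n b w Ab Aw"
    and x: "0 \<le> x" "x * eta n b w Ab Aw \<le> 1"
  shows "\<And>j. j \<in> D1 n b w Ab Aw \<Longrightarrow> Ab w * x - 1 \<le> Ab j * Aw j * x + Ab j + 1"
    and "\<And>k. k \<in> D2 n b w Ab Aw \<Longrightarrow> Ab k * Aw k * x - Ab k - 1 \<le> Ab w * x + 1"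
    and "\<And>j k. j \<in> D1 n b w Ab Aw \<Longrightarrow> k \<in> D2 n b w Ab Aw \<Longrightarrow>
           Ab k * Aw k * x - Ab k - 1 \<le> Ab j * Aw j * x + Ab j + 1"
proof -
  note sb = saaty_bounds[OF pcs]
  have clear: "x * d \<le> c" if "d / c \<le> eta n b w Ab Aw" "0 < c" for c d
  proof -
    have "x * (d / c) \<le> 1"
      using mult_left_mono[OF that(1) x(1)] x(2) by simp
    then show ?thesis using that(2) by (simp add: field_simps)
  qed
  {
    fix j assume j: "j \<in> D1 n b w Ab Aw"
    then have m: "j \<in> mid_criteria n b w" and lt: "Ab j * Aw j < Ab w" by (auto simp: D1_def)
    have "x * (Ab w - Ab j * Aw j) \<le> Ab j + 2"
      using eps1_le_eta[OF m, of Ab Aw] lt sb(2)[OF m] by (intro clear) (auto simp: eps1_def)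
    then show "Ab w * x - 1 \<le> Ab j * Aw j * x + Ab j + 1" by (simp add: algebra_simps)
  next
    fix k assume k: "k \<in> D2 n b w Ab Aw"
    then have m: "k \<in> mid_criteria n b w" and lt: "Ab w < Ab k * Aw k" by (auto simp: D2_def)
    have "x * (Ab k * Aw k - Ab w) \<le> Ab k + 2"
      using eps1_le_eta[OF m, of Ab Aw] lt sb(2)[OF m] by (intro clear) (auto simp: eps1_def)
    then show "Ab k * Aw k * x - Ab k - 1 \<le> Ab w * x + 1" by (simp add: algebra_simps)
  next
    fix j k assume jk: "j \<in> D1 n b w Ab Aw" "k \<in> D2 n b w Ab Aw"
    then have m: "j \<in> mid_criteria n b w" "k \<in> mid_criteria n b w"
      and lt: "Ab j * Aw j < Ab k * Aw k" by (auto simp: D1_def D2_def)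
    have "x * (Ab k * Aw k - Ab j * Aw j) \<le> Ab j + Ab k + 2"
      using eps2_le_eta[OF jk] lt sb(2)[OF m(1)] sb(2)[OF m(2)]
      by (intro clear) (auto simp: eps2_def)
    then show "Ab k * Aw k * x - Ab k - 1 \<le> Ab j * Aw j * x + Ab j + 1" by (simp add: algebra_simps)
  }
qed

text \<open>
  For given \<open>x\<close> and \<open>y\<close> the largest weight decreases in \<open>p\<close> and increases in \<open>q\<close>, so \<open>p = a\<close>, \<open>q = 1\<close> is the
  worst case. It serves for the criteria that do not determine \<open>x\<close> and \<open>y\<close>.
\<close>

lemma max_mid_weight_ge:
  assumes pcs: "is_saaty_pcs n b w Ab Aw" and k: "k \<in> mid_criteria n b w"
    and "0 \<le> x" "0 \<le> y"
  shows "min ((y + 1) / Ab w) (x + 1) \<le> max_mid_weight Ab Aw x y k"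
proof -
  have "(y + 1) / Ab w \<le> (y + 1) / Ab k"
    using saaty_bounds(2)[OF pcs k] assms by (intro divide_left_mono) auto
  moreover have "1 * x \<le> Aw k * x"
    using saaty_bounds(2)[OF pcs k] assms by (intro mult_right_mono) auto
  ultimately show ?thesis by (auto simp: max_mid_weight_def)
qed

section \<open>The three upper bounds\<close>

text \<open>
  Here \<open>y\<close> sits where \<open>a x - 1\<close> meets the upper bound of \<open>i\<close>. There criterion \<open>i\<close> has weight \<open>q x + 1\<close> and
  every other middle criterion has weight at least \<open>x\<close>, so the total is at least \<open>(n - 1 + a) x\<close>,
  with \<open>x = (p + 2) / (a - p q) \<ge> 3 / (a - 1)\<close>.
\<close>

lemma optimal_le_if_eta_eps1_D1:
  assumes n: "n \<ge> 3" and pcs: "is_saaty_pcs n b w Ab Aw" and opt: "optimal_value n b w Ab Aw \<epsilon>"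
    and i: "i \<in> D1 n b w Ab Aw" and eta: "eta n b w Ab Aw = eps1 w Ab Aw i"
  shows "\<epsilon> \<le> (Ab w - 1) / (3 * (real n - 1 + Ab w))"
proof -
  define a p q where "a = Ab w" and "p = Ab i" and "q = Aw i"
  have im: "i \<in> mid_criteria n b w" and lt: "p * q < a"
    using i by (auto simp: D1_def a_def p_def q_def)
  note sb = saaty_bounds[OF pcs]
  have pq: "1 \<le> p" "1 \<le> q" using sb(2)[OF im] by (auto simp: p_def q_def)
  then have "p * 1 \<le> p * q" by (intro mult_left_mono) auto
  then have ppq: "p \<le> p * q" by simp
  then have a1: "1 < a" using pq lt by linarith
  define x where "x = (p + 2) / (a - p * q)"
  define y where "y = a * x - 1"
  have x: "0 < x" using pq lt by (simp add: x_def)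
  have xeq: "x * (a - p * q) = p + 2" using lt by (simp add: x_def)
  have xeta: "x * eta n b w Ab Aw \<le> 1"
    unfolding eta eps1_def a_def[symmetric] p_def[symmetric] q_def[symmetric]
    using lt pq by (simp add: x_def abs_if)
  note bc = bounds_compatible[OF pcs less_imp_le[OF x] xeta]
  have y': "y = p * q * x + p + 1" using xeq by (simp add: y_def algebra_simps)
  have y0: "0 < y" unfolding y' using pq x by (auto intro!: add_nonneg_pos)
  have total: "\<epsilon> * (x + y + (\<Sum>k\<in>mid_criteria n b w. max_mid_weight Ab Aw x y k)) \<le> 1"
  proof (rule optimal_times_total_weight_le_1[OF pcs opt _ y0])
    show "0 \<le> x" using x by simp
    show "\<bar>y - Ab w * x\<bar> \<le> 1" by (simp add: y_def a_def)
    show "y \<le> Ab k * Aw k * x + Ab k + 1" if "k \<in> D1 n b w Ab Aw" for k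
      using bc(1)[OF that] by (simp add: y_def a_def)
    show "Ab k * Aw k * x - Ab k - 1 \<le> y" if "k \<in> D2 n b w Ab Aw" for k
      using bc(3)[OF i that] by (simp add: y' p_def q_def)
  qed
  have "x \<le> max_mid_weight Ab Aw x y k" if "k \<in> mid_criteria n b w" for k
  proof -
    have "min ((y + 1) / a) (x + 1) = x" using a1 by (simp add: y_def)
    then show ?thesis
      using max_mid_weight_ge[OF pcs that, of x y] x y0 by (simp add: a_def)
  qed
  then have "max_mid_weight Ab Aw x y i + real (n - 3) * x
      \<le> (\<Sum>k\<in>mid_criteria n b w. max_mid_weight Ab Aw x y k)"
    using sum_ge_special_plus_const[of "mid_criteria n b w" "{i}" x "max_mid_weight Ab Aw x y"] im
      card_mid_criteria[of n b w Ab Aw] pcs by (simp add: is_saaty_pcs_def)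
  moreover have "x + 1 \<le> max_mid_weight Ab Aw x y i"
  proof -
    have "1 * x \<le> q * x" using pq x by (intro mult_right_mono) auto
    moreover have "q * x + 1 \<le> (y + 1) / p" using pq by (simp add: y' field_simps)
    ultimately show ?thesis by (simp add: max_mid_weight_def p_def q_def)
  qed
  ultimately have "(real n - 1 + a) * x \<le> x + y + (\<Sum>k\<in>mid_criteria n b w. max_mid_weight Ab Aw x y k)"
    using n by (simp add: y_def of_nat_diff algebra_simps)
  moreover have "3 / (a - 1) \<le> x"
  proof -
    have "x * (a - p * q) \<le> x * (a - p)" using ppq x by simp
    then have "p + 2 \<le> x * (a - p)" using xeq by simp
    moreover have "0 \<le> (p - 1) * (a + 2)" using pq a1 by simp
    then have "3 * (a - p) \<le> (p + 2) * (a - 1)" by (simp add: algebra_simps)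
    moreover have "(p + 2) * (a - 1) \<le> x * (a - p) * (a - 1)"
      using calculation a1 by (intro mult_right_mono) auto
    ultimately have "3 * (a - p) \<le> x * (a - 1) * (a - p)" by (simp add: mult_ac)
    moreover have "0 < a - p" using ppq lt by simp
    ultimately have "3 \<le> x * (a - 1)" by (simp only: mult_le_cancel_right_pos)
    then show ?thesis using a1 by (simp add: field_simps)
  qed
  then have "(real n - 1 + a) * (3 / (a - 1)) \<le> (real n - 1 + a) * x"
    using n a1 by (intro mult_left_mono) auto
  moreover have "0 \<le> \<epsilon>" using opt by (force simp: optimal_value_def feasible_def)
  ultimately have "\<epsilon> * ((real n - 1 + a) * (3 / (a - 1))) \<le> 1"
    using total by (meson mult_left_mono order_trans)
  moreover have "0 < real n - 1 + a" using n a1 by simp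
  ultimately show ?thesis unfolding a_def[symmetric] using a1 by (simp add: field_simps)
qed

text \<open>
  Here \<open>y\<close> sits where \<open>a x + 1\<close> meets the lower bound of \<open>j\<close>. Every middle criterion then has weight at least
  \<open>x + 2 / a\<close>, and \<open>x = (p + 2) / (p q - a)\<close> is smallest for \<open>p = q = a\<close>.
\<close>

lemma optimal_le_if_eta_eps1_D2:
  assumes n: "n \<ge> 3" and pcs: "is_saaty_pcs n b w Ab Aw" and opt: "optimal_value n b w Ab Aw \<epsilon>"
    and j: "j \<in> D2 n b w Ab Aw" and eta: "eta n b w Ab Aw = eps1 w Ab Aw j"
  shows "\<epsilon> \<le> Ab w * (Ab w - 1) / (2 * (Ab w)\<^sup>2 + (3 * real n - 4) * Ab w + 2)"
proof -
  define a p q where "a = Ab w" and "p = Ab j" and "q = Aw j"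
  have jm: "j \<in> mid_criteria n b w" and gt: "a < p * q"
    using j by (auto simp: D2_def a_def p_def q_def)
  note sb = saaty_bounds[OF pcs]
  have pq: "1 \<le> p" "1 \<le> q" "p \<le> a" "q \<le> a" using sb(2)[OF jm] by (auto simp: p_def q_def a_def)
  have "p * q \<le> p * a" using pq by (intro mult_left_mono) auto
  then have pqa: "p * q \<le> a * p" by (simp add: mult.commute)
  have p1: "1 < p"
  proof (rule ccontr)
    assume "\<not> 1 < p"
    then have "p = 1" using pq by simp
    then show False using gt pq by simp
  qed
  \<comment> \<open>integrality: \<open>a \<ge> 2\<close> gives \<open>x + 2 / a \<le> x + 1\<close> below\<close>
  have "2 \<le> v" if "v \<in> saaty_scale" "1 < v" for v
    using that by (auto simp: saaty_scale_def)
  then have a2: "2 \<le> a"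
    using pcs p1 pq by (force simp: is_saaty_pcs_def is_pcs_def a_def)
  define x where "x = (p + 2) / (p * q - a)"
  define y where "y = a * x + 1"
  have x: "0 < x" using pq gt by (simp add: x_def)
  have xeq: "x * (p * q - a) = p + 2" using gt by (simp add: x_def)
  have xeta: "x * eta n b w Ab Aw \<le> 1"
    unfolding eta eps1_def a_def[symmetric] p_def[symmetric] q_def[symmetric]
    using gt pq by (simp add: x_def abs_if)
  note bc = bounds_compatible[OF pcs less_imp_le[OF x] xeta]
  have y': "y = p * q * x - p - 1" using xeq by (simp add: y_def algebra_simps)
  have y0: "0 < y" unfolding y_def using a2 x by (auto intro!: add_nonneg_pos)
  have total: "\<epsilon> * (x + y + (\<Sum>k\<in>mid_criteria n b w. max_mid_weight Ab Aw x y k)) \<le> 1"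
  proof (rule optimal_times_total_weight_le_1[OF pcs opt _ y0])
    show "0 \<le> x" using x by simp
    show "\<bar>y - Ab w * x\<bar> \<le> 1" by (simp add: y_def a_def)
    show "y \<le> Ab k * Aw k * x + Ab k + 1" if "k \<in> D1 n b w Ab Aw" for k
      using bc(3)[OF that j] by (simp add: y' p_def q_def)
    show "Ab k * Aw k * x - Ab k - 1 \<le> y" if "k \<in> D2 n b w Ab Aw" for k
      using bc(2)[OF that] by (simp add: y_def a_def)
  qed
  have "x + 2 / a \<le> max_mid_weight Ab Aw x y k" if "k \<in> mid_criteria n b w" for k
  proof -
    have "(y + 1) / a = x + 2 / a" using a2 by (simp add: y_def field_simps)
    then have "min ((y + 1) / a) (x + 1) = x + 2 / a" using a2 by simp
    then show ?thesis
      using max_mid_weight_ge[OF pcs that, of x y] x y0 by (simp add: a_def)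
  qed
  then have "real (n - 2) * (x + 2 / a) \<le> (\<Sum>k\<in>mid_criteria n b w. max_mid_weight Ab Aw x y k)"
    using sum_bounded_below[of "mid_criteria n b w" "x + 2 / a" "max_mid_weight Ab Aw x y"]
      card_mid_criteria[of n b w Ab Aw] pcs by (simp add: is_saaty_pcs_def)
  then have "(real n - 1 + a) * x + 1 + 2 * (real n - 2) / a
      \<le> x + y + (\<Sum>k\<in>mid_criteria n b w. max_mid_weight Ab Aw x y k)"
    using n by (simp add: y_def of_nat_diff diff_divide_distrib algebra_simps)
  moreover have "(a + 2) / (a * (a - 1)) \<le> x"
  proof -
    have "x * (p * q - a) \<le> x * (a * p - a)" using pqa x by simp
    then have "p + 2 \<le> x * (a * (p - 1))" using xeq by (simp add: algebra_simps)
    then have "(p + 2) * (a - 1) \<le> x * (a * (p - 1)) * (a - 1)"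
      using a2 by (intro mult_right_mono) auto
    moreover have "(a + 2) * (p - 1) \<le> (p + 2) * (a - 1)" using pq by (simp add: algebra_simps)
    ultimately have "(a + 2) * (p - 1) \<le> x * (a * (a - 1)) * (p - 1)" by (simp add: mult_ac)
    then have "a + 2 \<le> x * (a * (a - 1))" using p1 by simp
    moreover have "0 < a * (a - 1)" using a2 by simp
    ultimately show ?thesis by (simp add: pos_divide_le_eq)
  qed
  then have "(real n - 1 + a) * ((a + 2) / (a * (a - 1))) \<le> (real n - 1 + a) * x"
    using n a2 by (intro mult_left_mono) auto
  moreover have "(real n - 1 + a) * ((a + 2) / (a * (a - 1))) + 1 + 2 * (real n - 2) / a
      = (2 * a\<^sup>2 + (3 * real n - 4) * a + 2) / (a * (a - 1))"
  proof -
    have "a \<noteq> 0" "a - 1 \<noteq> 0" using a2 by auto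
    then show ?thesis by (simp add: divide_simps) (simp add: algebra_simps power2_eq_square)
  qed
  moreover have "0 \<le> \<epsilon>" using opt by (force simp: optimal_value_def feasible_def)
  ultimately have "\<epsilon> * ((2 * a\<^sup>2 + (3 * real n - 4) * a + 2) / (a * (a - 1))) \<le> 1"
    using total by (smt (verit) mult_left_mono)
  moreover have "0 < 2 * a\<^sup>2 + (3 * real n - 4) * a + 2"
    using n a2 by (auto intro!: add_nonneg_pos)
  moreover have "0 < a * (a - 1)" using a2 by simp
  ultimately show ?thesis unfolding a_def[symmetric] by (simp add: field_simps)
qed

text \<open>
  Here \<open>y\<close> sits where the upper bound of \<open>i\<close> meets the lower bound of \<open>j\<close>. Replacing \<open>q\<^sub>j\<close> by \<open>a\<close> and \<open>q\<^sub>i\<close> by \<open>1\<close>,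
  then \<open>p\<^sub>i\<close> by \<open>1\<close> and \<open>p\<^sub>j\<close> by \<open>a\<close>, only decreases \<open>x\<close> and leads to \<open>x \<ge> (a + 3) / (a\<^sup>2 - 1)\<close>; also
  \<open>y = p\<^sub>i q\<^sub>i x + p\<^sub>i + 1 \<ge> x + 2\<close>. The weights are increasing in \<open>x\<close> and \<open>y\<close>.
\<close>

lemma optimal_le_if_eta_eps2:
  assumes n: "n \<ge> 4" and pcs: "is_saaty_pcs n b w Ab Aw" and opt: "optimal_value n b w Ab Aw \<epsilon>"
    and i: "i \<in> D1 n b w Ab Aw" and j: "j \<in> D2 n b w Ab Aw"
    and eta: "eta n b w Ab Aw = eps2 Ab Aw i j"
  shows "\<epsilon> \<le> ((Ab w)\<^sup>2 - 1) / (3 * (Ab w)\<^sup>2 + 6 * Ab w + 7 +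
    (real n - 4) * min ((Ab w)\<^sup>2 + Ab w + 2) (1 + 3 * Ab w))"
proof -
  define a p q r s where "a = Ab w" and "p = Ab i" and "q = Aw i" and "r = Ab j" and "s = Aw j"
  have im: "i \<in> mid_criteria n b w" and jm: "j \<in> mid_criteria n b w"
    and lt: "p * q < a" and gt: "a < r * s" and ij: "i \<noteq> j"
    using i j by (auto simp: D1_def D2_def a_def p_def q_def r_def s_def)
  note sb = saaty_bounds[OF pcs]
  have le: "1 \<le> p" "1 \<le> q" "1 \<le> r" "r \<le> a" "s \<le> a"
    using sb(2)[OF im] sb(2)[OF jm] by (auto simp: p_def q_def r_def s_def a_def)
  have ppq: "p \<le> p * q" using le mult_left_mono[of 1 q p] by simp
  then have a1: "1 < a" using le lt by linarith
  have rsa: "r * s \<le> a * r" using le mult_left_mono[of s a r] by (simp add: mult.commute)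
  have sq: "0 < a\<^sup>2 - 1" using a1 by (simp add: one_less_power)
  define x where "x = (p + r + 2) / (r * s - p * q)"
  define y where "y = p * q * x + p + 1"
  have gap: "0 < r * s - p * q" using lt gt by simp
  have x: "0 < x" using le gap by (simp add: x_def)
  have xeq: "x * (r * s - p * q) = p + r + 2" using gap by (simp add: x_def)
  have xeta: "x * eta n b w Ab Aw \<le> 1"
    unfolding eta eps2_def p_def[symmetric] q_def[symmetric] r_def[symmetric] s_def[symmetric]
    using gap le by (simp add: x_def abs_if)
  note bc = bounds_compatible[OF pcs less_imp_le[OF x] xeta]
  have y': "y = r * s * x - r - 1" using xeq by (simp add: y_def algebra_simps)
  have y0: "0 < y" unfolding y_def using le x by (auto intro!: add_nonneg_pos)
  have total: "\<epsilon> * (x + y + (\<Sum>k\<in>mid_criteria n b w. max_mid_weight Ab Aw x y k)) \<le> 1"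
  proof (rule optimal_times_total_weight_le_1[OF pcs opt _ y0])
    show "0 \<le> x" using x by simp
    have "Ab w * x - 1 \<le> y" using bc(1)[OF i] by (simp add: y_def p_def q_def)
    moreover have "y \<le> Ab w * x + 1" using bc(2)[OF j] by (simp add: y' r_def s_def)
    ultimately show "\<bar>y - Ab w * x\<bar> \<le> 1" by (simp add: abs_le_iff)
    show "y \<le> Ab k * Aw k * x + Ab k + 1" if "k \<in> D1 n b w Ab Aw" for k
      using bc(3)[OF that j] by (simp add: y' r_def s_def)
    show "Ab k * Aw k * x - Ab k - 1 \<le> y" if "k \<in> D2 n b w Ab Aw" for k
      using bc(3)[OF i that] by (simp add: y_def p_def q_def)
  qed
  have n4: "real (n - 4) = real n - 4" using n by (simp add: of_nat_diff)
  have x_ge: "(a + 3) / (a\<^sup>2 - 1) \<le> x"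
  proof -
    have "x * (r * s - p * q) \<le> x * (a * r - p)" using rsa ppq x by (intro mult_left_mono) auto
    then have 1: "p + r + 2 \<le> x * (a * r - p)" using xeq by simp
    have pos: "0 < a * r - p" using rsa ppq gap by linarith
    \<comment> \<open>the cross-multiplied form of \<open>(a + 3) / (a\<^sup>2 - 1) \<le> (p + r + 2) / (a r - p)\<close>\<close>
    have "(p + r + 2) * (a\<^sup>2 - 1) - (a + 3) * (a * r - p)
        = (p - 1) * (a\<^sup>2 + a + 2) + (a - r) * (3 * a + 1)"
      by (simp add: algebra_simps power2_eq_square)
    moreover have "0 \<le> (p - 1) * (a\<^sup>2 + a + 2) + (a - r) * (3 * a + 1)"
      using le a1 by (intro add_nonneg_nonneg mult_nonneg_nonneg) auto
    ultimately have "(a + 3) * (a * r - p) \<le> (p + r + 2) * (a\<^sup>2 - 1)" by simp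
    also have "\<dots> \<le> x * (a * r - p) * (a\<^sup>2 - 1)" using 1 sq by (intro mult_right_mono) auto
    finally have "(a + 3) * (a * r - p) \<le> x * (a\<^sup>2 - 1) * (a * r - p)" by (simp add: mult_ac)
    then have "a + 3 \<le> x * (a\<^sup>2 - 1)" using pos by simp
    then show ?thesis using sq by (simp add: pos_divide_le_eq)
  qed
  have "1 * 1 * x \<le> p * q * x" using le x by (intro mult_mono) auto
  then have yx: "x + 2 \<le> y" using le by (simp add: y_def)
  define m where "m = min (a\<^sup>2 + a + 2) (1 + 3 * a)"
  have xb: "(a\<^sup>2 + a + 2) / (a\<^sup>2 - 1) \<le> x + 1"
  proof -
    have "(a\<^sup>2 + a + 2) / (a\<^sup>2 - 1) = (a + 3) / (a\<^sup>2 - 1) + 1" using sq by (simp add: field_simps)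
    then show ?thesis using x_ge by simp
  qed
  have yb: "(1 + 3 * a) / (a\<^sup>2 - 1) \<le> (y + 1) / a"
  proof -
    have "(1 + 3 * a) / (a\<^sup>2 - 1) = ((a + 3) / (a\<^sup>2 - 1) + 3) / a"
      using a1 less_1_mult[OF a1 a1]
      by (simp add: divide_simps power2_eq_square) (simp add: algebra_simps power2_eq_square)
    also have "\<dots> \<le> (y + 1) / a" using x_ge yx a1 by (intro divide_right_mono) auto
    finally show ?thesis .
  qed
  have "m / (a\<^sup>2 - 1) \<le> max_mid_weight Ab Aw x y k" if "k \<in> mid_criteria n b w" for k
  proof -
    have "m / (a\<^sup>2 - 1) \<le> (a\<^sup>2 + a + 2) / (a\<^sup>2 - 1)" "m / (a\<^sup>2 - 1) \<le> (1 + 3 * a) / (a\<^sup>2 - 1)"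
      unfolding m_def using sq by (auto intro!: divide_right_mono)
    then have "m / (a\<^sup>2 - 1) \<le> min ((y + 1) / a) (x + 1)" using xb yb by simp
    also have "\<dots> \<le> max_mid_weight Ab Aw x y k"
      unfolding a_def using x y0 by (intro max_mid_weight_ge[OF pcs that]) auto
    finally show ?thesis .
  qed
  then have "max_mid_weight Ab Aw x y i + max_mid_weight Ab Aw x y j + real (n - 4) * (m / (a\<^sup>2 - 1))
      \<le> (\<Sum>k\<in>mid_criteria n b w. max_mid_weight Ab Aw x y k)"
    using sum_ge_special_plus_const[of "mid_criteria n b w" "{i, j}" "m / (a\<^sup>2 - 1)"
        "max_mid_weight Ab Aw x y"] im jm ij
      card_mid_criteria[of n b w Ab Aw] pcs by (simp add: is_saaty_pcs_def)
  moreover have "(a\<^sup>2 + a + 2) / (a\<^sup>2 - 1) \<le> max_mid_weight Ab Aw x y i"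
  proof -
    have "1 * x \<le> q * x" using le x by (intro mult_right_mono) auto
    moreover have "q * x + 1 \<le> (y + 1) / p" using le by (simp add: y_def field_simps)
    ultimately show ?thesis using xb by (simp add: max_mid_weight_def p_def q_def)
  qed
  moreover have "(1 + 3 * a) / (a\<^sup>2 - 1) \<le> max_mid_weight Ab Aw x y j"
  proof -
    have "(y + 1) / a \<le> (y + 1) / r" using le y0 a1 by (intro divide_left_mono) auto
    moreover have "(y + 1) / r \<le> s * x + 1" using le by (simp add: y' field_simps)
    ultimately show ?thesis using yb by (simp add: max_mid_weight_def r_def s_def)
  qed
  moreover have "(3 * a\<^sup>2 + 6 * a + 7 + (real n - 4) * m) / (a\<^sup>2 - 1)
      = (a + 3) / (a\<^sup>2 - 1) + ((a + 3) / (a\<^sup>2 - 1) + 2) + (a\<^sup>2 + a + 2) / (a\<^sup>2 - 1)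
        + (1 + 3 * a) / (a\<^sup>2 - 1) + (real n - 4) * (m / (a\<^sup>2 - 1))"
    using sq by (simp add: divide_simps)
  ultimately have "(3 * a\<^sup>2 + 6 * a + 7 + (real n - 4) * m) / (a\<^sup>2 - 1)
      \<le> x + y + (\<Sum>k\<in>mid_criteria n b w. max_mid_weight Ab Aw x y k)"
    using x_ge yx by (simp only: n4)
  moreover have "0 \<le> \<epsilon>" using opt by (force simp: optimal_value_def feasible_def)
  ultimately have "\<epsilon> * ((3 * a\<^sup>2 + 6 * a + 7 + (real n - 4) * m) / (a\<^sup>2 - 1)) \<le> 1"
    using total by (meson mult_left_mono order_trans)
  moreover have "0 < 3 * a\<^sup>2 + 6 * a + 7 + (real n - 4) * m"
    using n a1 by (auto simp: m_def intro!: add_pos_nonneg)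
  ultimately show ?thesis
    unfolding a_def[symmetric] m_def[symmetric] using sq by (simp add: field_simps)
qed

section \<open>The extremal systems\<close>

lemma mid_criteria_1_n: "mid_criteria n (Suc 0) n = {2..<n}"
  by (auto simp: mid_criteria_def criteria_def)

lemma is_saaty_pcs_examples:
  assumes "a \<in> saaty_scale" "n \<ge> 3"
  shows "is_saaty_pcs n 1 n (Ab_ex1 a) (Aw_ex1 a)"
    and "is_saaty_pcs n 1 n (Ab_ex2 a) (Aw_ex2 a)"
    and "n \<ge> 4 \<Longrightarrow> is_saaty_pcs n 1 n (Ab_ex3 a) (Aw_ex3 a)"
proof -
  have "1 \<in> saaty_scale" by (simp add: saaty_scale_def)
  moreover have "1 \<le> a" using assms by (auto simp: saaty_scale_def)
  ultimately show "is_saaty_pcs n 1 n (Ab_ex1 a) (Aw_ex1 a)"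
    "is_saaty_pcs n 1 n (Ab_ex2 a) (Aw_ex2 a)"
    "n \<ge> 4 \<Longrightarrow> is_saaty_pcs n 1 n (Ab_ex3 a) (Aw_ex3 a)"
    using assms
    by (auto simp: is_saaty_pcs_def is_pcs_def criteria_def mid_criteria_def
        Ab_ex1_def Aw_ex1_def Ab_ex2_def Aw_ex2_def Ab_ex3_def Aw_ex3_def)
qed

text \<open>
  Since the optimal value is known to exist, no optimal weights of the extremal systems have to be
  exhibited: the bounds of the previous section provide the second premise.
\<close>

lemma optimal_valueI:
  assumes "is_pcs n b w Ab Aw"
    and "\<And>e. optimal_value n b w Ab Aw e \<Longrightarrow> e \<le> v"
    and "\<And>W e. feasible n b w Ab Aw W e \<Longrightarrow> v \<le> e"
  shows "optimal_value n b w Ab Aw v"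
proof -
  obtain e where e: "optimal_value n b w Ab Aw e"
    using optimal_value_ex1[OF assms(1)] by blast
  then have "v \<le> e" using assms(3) by (auto simp: optimal_value_def)
  then show ?thesis using assms(2)[OF e] e by simp
qed

text \<open>For \<open>a = 1\<close> the extremal systems are fully consistent and equal weights have no deviation.\<close>

lemma optimal_value_all_ones:
  assumes pcs: "is_pcs n b w Ab Aw" and "\<And>i. Ab i = 1" "\<And>i. Aw i = 1"
  shows "optimal_value n b w Ab Aw 0"
proof -
  have "n \<ge> 1" using pcs by (auto simp: is_pcs_def criteria_def)
  then have "feasible n b w Ab Aw (\<lambda>_. 1 / n) 0"
    using assms by (simp add: feasible_def criteria_def)
  moreover have "0 \<le> e" if "feasible n b w Ab Aw W e" for W e
    using that by (auto simp: feasible_def)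
  ultimately show ?thesis unfolding optimal_value_def by blast
qed

text \<open>
  The only critical criterion is \<open>2\<close>. Chaining constraints gives
  \<open>a W\<^sub>n \<le> W\<^sub>1 + \<epsilon> \<le> W\<^sub>2 + 2 \<epsilon> \<le> W\<^sub>n + 3 \<epsilon>\<close>, which bounds \<open>W\<^sub>n\<close> and then all other weights in terms of \<open>\<epsilon>\<close>.
\<close>

lemma optimal_value_example1:
  assumes n: "n \<ge> 3" and a: "a \<in> saaty_scale"
  shows "optimal_value n 1 n (Ab_ex1 a) (Aw_ex1 a) ((a - 1) / (3 * (real n - 1 + a)))"
proof (cases "a = 1")
  case True
  then show ?thesis
    using optimal_value_all_ones[of n 1 n "Ab_ex1 a" "Aw_ex1 a"] is_saaty_pcs_examples(1)[OF a n]
    by (simp add: is_saaty_pcs_def Ab_ex1_def Aw_ex1_def)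
next
  case False
  then have a1: "1 < a" using a by (auto simp: saaty_scale_def)
  note pcs = is_saaty_pcs_examples(1)[OF a n]
  then have pcs': "is_pcs n 1 n (Ab_ex1 a) (Aw_ex1 a)" by (simp add: is_saaty_pcs_def)
  have Abn: "Ab_ex1 a n = a" using n by (simp add: Ab_ex1_def)
  show ?thesis
  proof (rule optimal_valueI[OF pcs'])
    have D1: "D1 n (Suc 0) n (Ab_ex1 a) (Aw_ex1 a) = {2}"
      using n a1 by (auto simp: D1_def mid_criteria_1_n Ab_ex1_def Aw_ex1_def)
    have D2: "D2 n (Suc 0) n (Ab_ex1 a) (Aw_ex1 a) = {}"
      using n a1 by (auto simp: D2_def mid_criteria_1_n Ab_ex1_def Aw_ex1_def)
    have "eta n 1 n (Ab_ex1 a) (Aw_ex1 a) = eps1 n (Ab_ex1 a) (Aw_ex1 a) 2"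
      unfolding eta_def
    proof (rule Max_eqI[OF finite_eta_set])
      show "v \<le> eps1 n (Ab_ex1 a) (Aw_ex1 a) 2"
        if "v \<in> {eps1 n (Ab_ex1 a) (Aw_ex1 a) i | i. i \<in> mid_criteria n 1 n} \<union>
          {eps2 (Ab_ex1 a) (Aw_ex1 a) j k | j k. j \<in> D1 n 1 n (Ab_ex1 a) (Aw_ex1 a) \<and>
            k \<in> D2 n 1 n (Ab_ex1 a) (Aw_ex1 a)}" for v
        using that n a1 by (auto simp: D2 mid_criteria_1_n eps1_def Ab_ex1_def Aw_ex1_def)
    qed (use n in \<open>auto simp: mid_criteria_1_n\<close>)
    then show "e \<le> (a - 1) / (3 * (real n - 1 + a))"
      if "optimal_value n 1 n (Ab_ex1 a) (Aw_ex1 a) e" for e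
      using optimal_le_if_eta_eps1_D1[OF n pcs that, of 2] by (simp add: D1 Abn)
  next
    fix W e assume F: "feasible n 1 n (Ab_ex1 a) (Aw_ex1 a) W e"
    \<comment> \<open>the bound on \<open>W\<^sub>n\<close> from the chain of constraints\<close>
    define X where "X = 3 * e / (a - 1)"
    have X: "X * (a - 1) = 3 * e" using a1 by (simp add: X_def)
    have bw: "\<bar>W 1 - a * W n\<bar> \<le> e" using F Abn by (simp add: feasible_def)
    have "2 \<in> mid_criteria n 1 n" using n by (simp add: mid_criteria_1_n)
    then have "\<bar>W 1 - Ab_ex1 a 2 * W 2\<bar> \<le> e \<and> \<bar>W 2 - Aw_ex1 a 2 * W n\<bar> \<le> e"
      using F by (auto simp: feasible_def)
    then have 2: "\<bar>W 1 - W 2\<bar> \<le> e" "\<bar>W 2 - W n\<bar> \<le> e"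
      by (simp_all add: Ab_ex1_def Aw_ex1_def)
    have "(a - 1) * W n \<le> 3 * e" using bw 2 by (simp add: algebra_simps abs_le_iff)
    then have Wn: "W n \<le> X" using a1 by (simp add: X_def field_simps)
    have "W k \<le> X" if k: "k \<in> mid_criteria n 1 n - {2}" for k
    proof -
      have "\<bar>W 1 - Ab_ex1 a k * W k\<bar> \<le> e" using F k by (auto simp: feasible_def)
      moreover have "Ab_ex1 a k = a" using k by (auto simp: mid_criteria_1_n Ab_ex1_def)
      ultimately have "a * W k \<le> X + 3 * e" using 2 Wn by (simp add: abs_le_iff)
      also have "\<dots> = a * X" using X by (simp add: algebra_simps)
      finally show ?thesis using a1 by simp
    qed
    then have "(\<Sum>k\<in>mid_criteria n 1 n. W k) \<le> W 2 + real (n - 3) * X"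
      using sum_le_special_plus_const[of "mid_criteria n 1 n" "{2}" W X] n
      by (simp add: mid_criteria_1_n)
    moreover have "W 1 + W n + (\<Sum>k\<in>mid_criteria n 1 n. W k) = 1"
      using F sum_criteria[OF pcs', of W] by (simp add: feasible_def)
    ultimately have "1 \<le> (real n - 1 + a) * X"
      using 2 Wn X n by (simp add: of_nat_diff algebra_simps abs_le_iff)
    then have "a - 1 \<le> e * (3 * (real n - 1 + a))"
      using a1 by (simp add: X_def field_simps)
    then show "(a - 1) / (3 * (real n - 1 + a)) \<le> e"
      using n a1 by (simp add: pos_divide_le_eq)
  qed
qed

text \<open>
  Again criterion \<open>2\<close> is critical, now through
  \<open>a\<^sup>2 W\<^sub>n \<le> a W\<^sub>2 + a \<epsilon> \<le> W\<^sub>1 + (a + 1) \<epsilon> \<le> a W\<^sub>n + (a + 2) \<epsilon>\<close>.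
\<close>

lemma optimal_value_example2:
  assumes n: "n \<ge> 3" and a: "a \<in> saaty_scale"
  shows "optimal_value n 1 n (Ab_ex2 a) (Aw_ex2 a)
    (a * (a - 1) / (2 * a\<^sup>2 + (3 * real n - 4) * a + 2))"
proof (cases "a = 1")
  case True
  then show ?thesis
    using optimal_value_all_ones[of n 1 n "Ab_ex2 a" "Aw_ex2 a"] is_saaty_pcs_examples(2)[OF a n]
    by (simp add: is_saaty_pcs_def Ab_ex2_def Aw_ex2_def)
next
  case False
  then have a1: "1 < a" using a by (auto simp: saaty_scale_def)
  note pcs = is_saaty_pcs_examples(2)[OF a n]
  then have pcs': "is_pcs n 1 n (Ab_ex2 a) (Aw_ex2 a)" by (simp add: is_saaty_pcs_def)
  have Abn: "Ab_ex2 a n = a" using n by (simp add: Ab_ex2_def)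
  show ?thesis
  proof (rule optimal_valueI[OF pcs'])
    have D1: "D1 n (Suc 0) n (Ab_ex2 a) (Aw_ex2 a) = {}"
      using n a1 by (auto simp: D1_def mid_criteria_1_n Ab_ex2_def Aw_ex2_def)
    have D2: "D2 n (Suc 0) n (Ab_ex2 a) (Aw_ex2 a) = {2}"
      using n a1 by (auto simp: D2_def mid_criteria_1_n Ab_ex2_def Aw_ex2_def)
    have "eta n 1 n (Ab_ex2 a) (Aw_ex2 a) = eps1 n (Ab_ex2 a) (Aw_ex2 a) 2"
      unfolding eta_def
    proof (rule Max_eqI[OF finite_eta_set])
      show "v \<le> eps1 n (Ab_ex2 a) (Aw_ex2 a) 2"
        if "v \<in> {eps1 n (Ab_ex2 a) (Aw_ex2 a) i | i. i \<in> mid_criteria n 1 n} \<union>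
          {eps2 (Ab_ex2 a) (Aw_ex2 a) j k | j k. j \<in> D1 n 1 n (Ab_ex2 a) (Aw_ex2 a) \<and>
            k \<in> D2 n 1 n (Ab_ex2 a) (Aw_ex2 a)}" for v
        using that n a1 by (auto simp: D1 mid_criteria_1_n eps1_def Ab_ex2_def Aw_ex2_def)
    qed (use n in \<open>auto simp: mid_criteria_1_n\<close>)
    then show "e \<le> a * (a - 1) / (2 * a\<^sup>2 + (3 * real n - 4) * a + 2)"
      if "optimal_value n 1 n (Ab_ex2 a) (Aw_ex2 a) e" for e
      using optimal_le_if_eta_eps1_D2[OF n pcs that, of 2] by (simp add: D2 Abn)
  next
    fix W e assume F: "feasible n 1 n (Ab_ex2 a) (Aw_ex2 a) W e"
    \<comment> \<open>the bound on \<open>W\<^sub>n\<close> from the chain of constraints\<close>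
    define X where "X = (a + 2) * e / (a * (a - 1))"
    have bw: "\<bar>W 1 - a * W n\<bar> \<le> e" using F Abn by (simp add: feasible_def)
    have best: "\<bar>W 1 - a * W k\<bar> \<le> e" if k: "k \<in> mid_criteria n 1 n" for k
    proof -
      have "\<bar>W 1 - Ab_ex2 a k * W k\<bar> \<le> e" using F k by (auto simp: feasible_def)
      moreover have "Ab_ex2 a k = a" using k by (auto simp: mid_criteria_1_n Ab_ex2_def)
      ultimately show ?thesis by simp
    qed
    have mid2: "2 \<in> mid_criteria n 1 n" using n by (simp add: mid_criteria_1_n)
    then have "\<bar>W 2 - Aw_ex2 a 2 * W n\<bar> \<le> e" using F by (auto simp: feasible_def)
    then have "a * W n \<le> W 2 + e" by (simp add: Aw_ex2_def abs_le_iff)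
    then have "a * (a * W n) \<le> a * (W 2 + e)" using a1 by (intro mult_left_mono) auto
    then have "a * (a - 1) * W n \<le> (a + 2) * e"
      using bw best[OF mid2] by (simp add: algebra_simps abs_le_iff)
    moreover have pos: "0 < a * (a - 1)" using a1 by simp
    ultimately have Wn: "W n \<le> X" by (simp add: X_def pos_le_divide_eq mult.commute)
    then have aWn: "a * W n \<le> a * X" using a1 by simp
    have "W k \<le> X + 2 * e / a" if k: "k \<in> mid_criteria n 1 n" for k
    proof -
      have "a * W k \<le> a * X + 2 * e" using best[OF k] bw aWn by (simp add: abs_le_iff)
      also have "\<dots> = a * (X + 2 * e / a)" using a1 by (simp add: algebra_simps)
      finally show ?thesis using a1 by simp
    qed
    then have "(\<Sum>k\<in>mid_criteria n 1 n. W k) \<le> real (n - 2) * (X + 2 * e / a)"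
      using sum_bounded_above[of "mid_criteria n 1 n" W "X + 2 * e / a"] n
      by (simp add: mid_criteria_1_n)
    moreover have "W 1 + W n + (\<Sum>k\<in>mid_criteria n 1 n. W k) = 1"
      using F sum_criteria[OF pcs', of W] by (simp add: feasible_def)
    ultimately have "1 \<le> (real n - 1 + a) * X + e + (real n - 2) * (2 * e / a)"
      using bw aWn Wn n by (simp add: of_nat_diff algebra_simps abs_le_iff)
    also have "\<dots> = e * (2 * a\<^sup>2 + (3 * real n - 4) * a + 2) / (a * (a - 1))"
    proof -
      have "a \<noteq> 0" "a - 1 \<noteq> 0" using a1 by auto
      then show ?thesis
        by (simp add: X_def divide_simps) (simp add: algebra_simps power2_eq_square)
    qed
    finally have "a * (a - 1) \<le> e * (2 * a\<^sup>2 + (3 * real n - 4) * a + 2)"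
      using pos by (simp add: pos_le_divide_eq)
    moreover have "0 < 2 * a\<^sup>2 + (3 * real n - 4) * a + 2"
      using n a1 by (auto intro!: add_nonneg_pos)
    ultimately show "a * (a - 1) / (2 * a\<^sup>2 + (3 * real n - 4) * a + 2) \<le> e"
      by (simp add: pos_divide_le_eq)
  qed
qed

text \<open>
  Criteria \<open>2\<close> and \<open>3\<close> are critical together:
  \<open>a\<^sup>2 W\<^sub>n \<le> a W\<^sub>3 + a \<epsilon> \<le> W\<^sub>1 + (a + 1) \<epsilon> \<le> W\<^sub>2 + (a + 2) \<epsilon> \<le> W\<^sub>n + (a + 3) \<epsilon>\<close>. The minimum in the value arises
  because a further criterion \<open>k\<close> is bounded both by \<open>a W\<^sub>k \<le> W\<^sub>1 + \<epsilon>\<close> and by \<open>W\<^sub>k \<le> W\<^sub>n + \<epsilon>\<close>.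
\<close>

lemma optimal_value_example3:
  assumes n: "n \<ge> 4" and a: "a \<in> saaty_scale"
  shows "optimal_value n 1 n (Ab_ex3 a) (Aw_ex3 a)
    ((a\<^sup>2 - 1) / (3 * a\<^sup>2 + 6 * a + 7 + (real n - 4) * min (a\<^sup>2 + a + 2) (1 + 3 * a)))"
proof (cases "a = 1")
  case True
  then show ?thesis
    using optimal_value_all_ones[of n 1 n "Ab_ex3 a" "Aw_ex3 a"] is_saaty_pcs_examples(3)[OF a _ n] n
    by (simp add: is_saaty_pcs_def Ab_ex3_def Aw_ex3_def)
next
  case False
  then have a1: "1 < a" using a by (auto simp: saaty_scale_def)
  have sq: "0 < a\<^sup>2 - 1" using a1 by (simp add: one_less_power)
  have pcs: "is_saaty_pcs n 1 n (Ab_ex3 a) (Aw_ex3 a)"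
    using is_saaty_pcs_examples(3)[OF a _ n] n by simp
  then have pcs': "is_pcs n 1 n (Ab_ex3 a) (Aw_ex3 a)" by (simp add: is_saaty_pcs_def)
  have Abn: "Ab_ex3 a n = a" using n by (simp add: Ab_ex3_def)
  define m where "m = min (a\<^sup>2 + a + 2) (1 + 3 * a)"
  have "optimal_value n 1 n (Ab_ex3 a) (Aw_ex3 a)
    ((a\<^sup>2 - 1) / (3 * a\<^sup>2 + 6 * a + 7 + (real n - 4) * m))"
  proof (rule optimal_valueI[OF pcs'])
    have D1: "D1 n (Suc 0) n (Ab_ex3 a) (Aw_ex3 a) = {2}"
      using n a1 by (auto simp: D1_def mid_criteria_1_n Ab_ex3_def Aw_ex3_def)
    have D2: "D2 n (Suc 0) n (Ab_ex3 a) (Aw_ex3 a) = {3}"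
      using n a1 by (auto simp: D2_def mid_criteria_1_n Ab_ex3_def Aw_ex3_def)
    have eps2: "eps2 (Ab_ex3 a) (Aw_ex3 a) 2 3 = (a\<^sup>2 - 1) / (a + 3)"
      using sq by (simp add: eps2_def Ab_ex3_def Aw_ex3_def power2_eq_square)
    have "eps1 n (Ab_ex3 a) (Aw_ex3 a) i \<le> (a\<^sup>2 - 1) / (a + 3)"
      if i: "i \<in> mid_criteria n 1 n" for i
    proof -
      consider "i = 2" | "i = 3" | "3 < i" using i by (fastforce simp: mid_criteria_1_n)
      then show ?thesis
      proof cases
        case 1
        have "(a - 1) * (a + 3) \<le> (a - 1) * (3 * (a + 1))"
          using a1 by (intro mult_left_mono) auto
        then have "(a - 1) / 3 \<le> (a\<^sup>2 - 1) / (a + 3)"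
          using a1 by (simp add: divide_simps) (simp add: algebra_simps power2_eq_square)
        then show ?thesis using 1 n a1 by (simp add: eps1_def Ab_ex3_def Aw_ex3_def)
      next
        case 2
        have "(a - 1) * (a * (a + 3)) \<le> (a - 1) * ((a + 1) * (a + 2))"
          using a1 by (intro mult_left_mono) (auto simp: algebra_simps)
        then have "(a * a - a) / (a + 2) \<le> (a\<^sup>2 - 1) / (a + 3)"
          using a1 by (simp add: divide_simps) (simp add: algebra_simps power2_eq_square)
        then show ?thesis using 2 n a1 by (simp add: eps1_def Ab_ex3_def Aw_ex3_def)
      next
        case 3
        then show ?thesis using n a1 sq by (simp add: eps1_def Ab_ex3_def Aw_ex3_def)
      qed
    qed
    then have "eta n 1 n (Ab_ex3 a) (Aw_ex3 a) = eps2 (Ab_ex3 a) (Aw_ex3 a) 2 3"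
      unfolding eta_def by (intro Max_eqI[OF finite_eta_set]) (auto simp: D1 D2 eps2)
    then show "e \<le> (a\<^sup>2 - 1) / (3 * a\<^sup>2 + 6 * a + 7 + (real n - 4) * m)"
      if "optimal_value n 1 n (Ab_ex3 a) (Aw_ex3 a) e" for e
      using optimal_le_if_eta_eps2[OF n pcs that, of 2 3] by (simp add: D1 D2 Abn m_def)
  next
    fix W e assume F: "feasible n 1 n (Ab_ex3 a) (Aw_ex3 a) W e"
    \<comment> \<open>the bound on \<open>W\<^sub>n\<close> from the chain of constraints\<close>
    define X where "X = (a + 3) * e / (a\<^sup>2 - 1)"
    have bw: "\<bar>W 1 - a * W n\<bar> \<le> e" using F Abn by (simp add: feasible_def)
    have mid: "\<bar>W 1 - Ab_ex3 a k * W k\<bar> \<le> e" "\<bar>W k - Aw_ex3 a k * W n\<bar> \<le> e"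
      if "k \<in> mid_criteria n 1 n" for k
      using F that by (auto simp: feasible_def)
    have 2: "\<bar>W 1 - W 2\<bar> \<le> e" "\<bar>W 2 - W n\<bar> \<le> e"
      using mid[of 2] n by (simp_all add: mid_criteria_1_n Ab_ex3_def Aw_ex3_def)
    have 3: "\<bar>W 1 - a * W 3\<bar> \<le> e" "\<bar>W 3 - a * W n\<bar> \<le> e"
      using mid[of 3] n by (simp_all add: mid_criteria_1_n Ab_ex3_def Aw_ex3_def)
    have "a * W n \<le> W 3 + e" using 3 by (simp add: abs_le_iff)
    then have "a * (a * W n) \<le> a * (W 3 + e)" using a1 by (intro mult_left_mono) auto
    then have "(a\<^sup>2 - 1) * W n \<le> (a + 3) * e"
      using 2 3 by (simp add: algebra_simps power2_eq_square abs_le_iff)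
    then have Wn: "W n \<le> X" using sq by (simp add: X_def pos_le_divide_eq mult.commute)
    have W1: "W 1 \<le> X + 2 * e" and W2: "W 2 \<le> X + e"
      using 2 Wn by (auto simp: abs_le_iff)
    have aux: "v \<le> (1 + 3 * a) * e / (a\<^sup>2 - 1)" if "\<bar>W 1 - a * v\<bar> \<le> e" for v
    proof -
      have "a * v \<le> X + 3 * e" using that W1 by (simp add: abs_le_iff)
      also have "\<dots> = a * ((1 + 3 * a) * e / (a\<^sup>2 - 1))"
        using a1 less_1_mult[OF a1 a1]
        by (simp add: X_def divide_simps power2_eq_square) (simp add: algebra_simps power2_eq_square)
      finally show ?thesis using a1 by (simp only: mult_le_cancel_left_pos)
    qed
    have X1: "X + e = (a\<^sup>2 + a + 2) * e / (a\<^sup>2 - 1)"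
      using sq by (simp add: X_def divide_simps) (simp add: algebra_simps)
    have "W k \<le> m * e / (a\<^sup>2 - 1)" if k: "k \<in> mid_criteria n 1 n - {2, 3}" for k
    proof -
      have "Ab_ex3 a k = a" "Aw_ex3 a k = 1"
        using k by (auto simp: mid_criteria_1_n Ab_ex3_def Aw_ex3_def)
      then have "\<bar>W 1 - a * W k\<bar> \<le> e" "\<bar>W k - W n\<bar> \<le> e" using mid[of k] k by auto
      then have "W k \<le> (1 + 3 * a) * e / (a\<^sup>2 - 1)" "W k \<le> (a\<^sup>2 + a + 2) * e / (a\<^sup>2 - 1)"
        using aux Wn unfolding X1[symmetric] by (auto simp: abs_le_iff)
      then show ?thesis unfolding m_def min_def by simp
    qed
    then have "(\<Sum>k\<in>mid_criteria n 1 n. W k) \<le> W 2 + W 3 + real (n - 4) * (m * e / (a\<^sup>2 - 1))"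
      using sum_le_special_plus_const[of "mid_criteria n 1 n" "{2, 3}" W "m * e / (a\<^sup>2 - 1)"] n
      by (simp add: mid_criteria_1_n)
    moreover have "W 1 + W n + (\<Sum>k\<in>mid_criteria n 1 n. W k) = 1"
      using F sum_criteria[OF pcs', of W] by (simp add: feasible_def)
    ultimately have "1 \<le> X + (X + 2 * e) + (X + e) + (1 + 3 * a) * e / (a\<^sup>2 - 1)
        + (real n - 4) * (m * e / (a\<^sup>2 - 1))"
      using W1 W2 Wn aux[OF 3(1)] n by (simp add: of_nat_diff)
    also have "\<dots> = e * (3 * a\<^sup>2 + 6 * a + 7 + (real n - 4) * m) / (a\<^sup>2 - 1)"
      using sq by (simp add: X_def divide_simps) (simp add: algebra_simps)
    finally have "a\<^sup>2 - 1 \<le> e * (3 * a\<^sup>2 + 6 * a + 7 + (real n - 4) * m)"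
      using sq by (simp add: pos_le_divide_eq)
    moreover have "0 < 3 * a\<^sup>2 + 6 * a + 7 + (real n - 4) * m"
      using n a1 by (auto simp: m_def intro!: add_pos_nonneg)
    ultimately show "(a\<^sup>2 - 1) / (3 * a\<^sup>2 + 6 * a + 7 + (real n - 4) * m) \<le> e"
      by (simp add: pos_divide_le_eq)
  qed
  then show ?thesis by (simp add: m_def)
qed

theorem theorem3:
  fixes n b w :: nat and Ab Aw :: "nat \<Rightarrow> real" and a \<epsilon> :: real
  assumes n: "n \<ge> 3"
    and pcs: "is_saaty_pcs n b w Ab Aw"
    and a: "a = Ab w"
    and opt: "optimal_value n b w Ab Aw \<epsilon>"
  shows
    "(((\<exists>i0\<in>D1 n b w Ab Aw. eta n b w Ab Aw = eps1 w Ab Aw i0) \<longrightarrow>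
        \<epsilon> \<le> (a - 1) / (3 * (real n - 1 + a))) \<and>
     is_saaty_pcs n 1 n (Ab_ex1 a) (Aw_ex1 a) \<and> Ab_ex1 a n = a \<and>
     optimal_value n 1 n (Ab_ex1 a) (Aw_ex1 a)
       ((a - 1) / (3 * (real n - 1 + a)))) \<and>
     (((\<exists>j0\<in>D2 n b w Ab Aw. eta n b w Ab Aw = eps1 w Ab Aw j0) \<longrightarrow>
        \<epsilon> \<le> a * (a - 1) / (2 * a\<^sup>2 + (3 * real n - 4) * a + 2)) \<and>
     is_saaty_pcs n 1 n (Ab_ex2 a) (Aw_ex2 a) \<and> Ab_ex2 a n = a \<and>
     optimal_value n 1 n (Ab_ex2 a) (Aw_ex2 a)
       (a * (a - 1) / (2 * a\<^sup>2 + (3 * real n - 4) * a + 2))) \<and>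
     (n \<ge> 4 \<longrightarrow>
     ((\<exists>i0\<in>D1 n b w Ab Aw. \<exists>j0\<in>D2 n b w Ab Aw. eta n b w Ab Aw = eps2 Ab Aw i0 j0) \<longrightarrow>
        \<epsilon> \<le> (a\<^sup>2 - 1) /
              (3 * a\<^sup>2 + 6 * a + 7 + (real n - 4) * min (a\<^sup>2 + a + 2) (1 + 3 * a))) \<and>
     is_saaty_pcs n 1 n (Ab_ex3 a) (Aw_ex3 a) \<and> Ab_ex3 a n = a \<and>
     optimal_value n 1 n (Ab_ex3 a) (Aw_ex3 a)
       ((a\<^sup>2 - 1) /
          (3 * a\<^sup>2 + 6 * a + 7 + (real n - 4) * min (a\<^sup>2 + a + 2) (1 + 3 * a))))"
proof -
  have scale: "a \<in> saaty_scale"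
    using pcs a by (auto simp: is_saaty_pcs_def is_pcs_def)
  have "Ab_ex1 a n = a" "Ab_ex2 a n = a" "n \<ge> 4 \<Longrightarrow> Ab_ex3 a n = a"
    using n by (auto simp: Ab_ex1_def Ab_ex2_def Ab_ex3_def)
  then show ?thesis
    using optimal_le_if_eta_eps1_D1[OF n pcs opt] optimal_le_if_eta_eps1_D2[OF n pcs opt]
      optimal_le_if_eta_eps2[OF _ pcs opt] is_saaty_pcs_examples[OF scale n]
      optimal_value_example1[OF n scale] optimal_value_example2[OF n scale] optimal_value_example3[OF _ scale]
    unfolding a[symmetric] by blast
qed

end
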